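(* For every integer $n\ge0$ let $$P_n=P_n(q)=\sum_{j\ge0}\sum_{k\ge0}(-1)^kq^{2j^2+2j+k}\begin{bmatrix} 2j+k\\ k\end{bmatrix}_{q}\begin{bmatrix} n-j-k\\ j\end{bmatrix}_{q^2}.$$ Then $$P_n=\sum_{j=-\infty}^\infty(-1)^jq^{j(7j+5)/2}\begin{bmatrix} n+1\\ \left\lfloor\frac{2n+7j+6}{4}\right\rfloor\end{bmatrix}_{q^2},$$ and $P_0=1$, $P_1=-q+1$, $P_2=q^4+q^2-q+1$, and $P_n=(1-q-q^2)P_{n-1}+(q^{2n}-q^3+q^2+q)P_{n-2}+q^3P_{n-3}$ for $n\ge3$.
   Context: $q$ is an indeterminate. $(a;p)_n=\prod_{i=0}^{n-1}(1-ap^i)$. The Gaussian polynomial in base $p$ is $\begin{bmatrix} A\\ B\end{bmatrix}_{p}=\frac{(p;p)_A}{(p;p)_B(p;p)_{A-B}}$ if $0\le B\le A$, and $0$ otherwise. All sums have only finitely many nonzero terms. *)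

theory Defs
  imports "HOL-Computational_Algebra.Computational_Algebra" "HOL-Library.Groups_Big_Fun"
begin

text \<open>
  Everything is computed in the field of rational functions over the integers, i.e. the
  fraction field of the ring of integer polynomials; \<open>q\<close> is the indeterminate.
\<close>

definition q :: "int poly fract" where
  "q = Fraction_Field.Fract [:0, 1:] 1"

definition qpoch :: "'a::comm_ring_1 \<Rightarrow> 'a \<Rightarrow> nat \<Rightarrow> 'a" where
  "qpoch a p n = (\<Prod>i<n. 1 - a * p ^ i)"

text \<open>
  The arguments are integers since the top and bottom entries may be negative. The quotient
  is meaningful as long as \<open>p\<close> is not a root of unity, which holds for the bases
  \<open>q\<close> and \<open>q\<^sup>2\<close>.
\<close>

definition gauss_poly :: "'a::field \<Rightarrow> int \<Rightarrow> int \<Rightarrow> 'a" where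
  "gauss_poly p A B =
     (if 0 \<le> B \<and> B \<le> A
      then qpoch p p (nat A) / (qpoch p p (nat B) * qpoch p p (nat (A - B)))
      else 0)"

text \<open>
  \<^const>\<open>Sum_any\<close> adds up the nonzero values of a function of finite support (and would be
  0 for infinite support); the finiteness of all supports involved is proved below.
\<close>

definition P_term :: "nat \<Rightarrow> nat \<Rightarrow> nat \<Rightarrow> int poly fract" where
  "P_term n j k =
     (-1) ^ k * q ^ (2 * j\<^sup>2 + 2 * j + k)
       * gauss_poly q (2 * int j + int k) (int k)
       * gauss_poly (q\<^sup>2) (int n - int j - int k) (int j)"

definition P :: "nat \<Rightarrow> int poly fract" where
  "P n = Sum_any (\<lambda>j. Sum_any (\<lambda>k. P_term n j k))"

text \<open>
  Second sum: the exponent \<open>j (7 j + 5) / 2\<close> is a nonnegative integer for every integer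
  \<open>j\<close>, so \<open>div 2\<close> is exact there, while \<open>div 4\<close> is the floor.
\<close>

lemma exponent_even: "even (j * (7 * j + 5))" for j :: int
  by auto

lemma exponent_nonneg: "0 \<le> j * (7 * j + 5)" for j :: int
  by (cases "0 \<le> j") (auto intro: mult_nonneg_nonneg mult_nonpos_nonpos)

lemma floor_index:
  "(2 * int n + 7 * j + 6) div 4 = \<lfloor>of_int (2 * int n + 7 * j + 6) / (4 :: rat)\<rfloor>"
  using floor_divide_of_int_eq[of "2 * int n + 7 * j + 6" 4, where ?'a = rat] by simp

lemma P_term_eq_0: "P_term n j k = 0" if "n < 2 * j + k"
  using that by (simp add: P_term_def gauss_poly_def)

lemma finite_support_inner: "finite {k. P_term n j k \<noteq> 0}"
proof (rule finite_subset[of _ "{..n}"])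
  show "{k. P_term n j k \<noteq> 0} \<subseteq> {..n}"
    using P_term_eq_0[of n j] by (force simp: not_less[symmetric])
qed simp

lemma finite_support_outer: "finite {j. Sum_any (\<lambda>k. P_term n j k) \<noteq> 0}"
proof (rule finite_subset[of _ "{..n}"])
  show "{j. Sum_any (\<lambda>k. P_term n j k) \<noteq> 0} \<subseteq> {..n}"
  proof (rule subsetI, rule ccontr)
    fix j assume j: "j \<in> {j. Sum_any (\<lambda>k. P_term n j k) \<noteq> 0}" "j \<notin> {..n}"
    then have "P_term n j = (\<lambda>k. 0)"
      by (auto intro!: P_term_eq_0)
    with j show False by simp
  qed
qed simp

lemma finite_support_second_sum:
  "finite {j :: int. (-1) powi j * q powi (j * (7 * j + 5) div 2)
      * gauss_poly (q\<^sup>2) (int n + 1) ((2 * int n + 7 * j + 6) div 4) \<noteq> 0}"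
  by (rule finite_subset[of _ "{- int n - 6 .. int n + 6}"])
    (auto simp: gauss_poly_def split: if_splits)

lemma q_power_neq_1: "q ^ m \<noteq> 1" if "m > 0"
proof
  have q_pow: "q ^ k = Fraction_Field.Fract ([:0, 1:] ^ k) 1" for k
    by (induction k) (auto simp: q_def One_fract_def)
  assume "q ^ m = 1"
  then have "[:0, 1:] ^ m = (1 :: int poly)"
    by (simp add: q_pow One_fract_def eq_fract)
  then have "poly ([:0, 1:] ^ m) 0 = poly (1 :: int poly) 0"
    by (rule arg_cong)
  with that show False
    by (simp add: poly_power power_0_left)
qed

end

theory Submission
  imports Defs
begin

text \<open>
  Both sides satisfy the same recurrence of order three and have the same first three values.

  For the double sum this is a matter of generating functions. Summing over \<open>n\<close> turns the
  summand with index \<open>j\<close> into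
  \<open>t\<^sub>j(x) = q\<^bsup>2j(j+1)\<^esup> x\<^bsup>2j\<^esup> / ((x;q\<^sup>2)\<^bsub>j+1\<^esub> (-qx;q)\<^bsub>2j+1\<^esub>)\<close>,
  and lowering \<open>j\<close> by one amounts to replacing \<open>x\<close> by \<open>q\<^sup>2 x\<close>:
  \<open>(1 - x)(1 + qx)(1 + q\<^sup>2 x) t\<^bsub>j+1\<^esub>(x) = q\<^sup>4 x\<^sup>2 t\<^sub>j(q\<^sup>2 x)\<close>
  (lemma \<open>P_summand_fps_Suc\<close>). Adding up over \<open>j\<close>, the generating function \<open>G\<close> of the \<open>P n\<close>
  satisfies \<open>(1 - x)(1 + qx)(1 + q\<^sup>2 x) G(x) = 1 + q\<^sup>2 x + q\<^sup>4 x\<^sup>2 G(q\<^sup>2 x)\<close>; comparing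
  coefficients gives the recurrence together with the initial values.

  For the alternating sum, the recurrence holds only after summation over \<open>j\<close>: the defect of the
  \<open>j\<close>-th term is a difference \<open>telescoper n j - telescoper n (j - 1)\<close>
  (lemma \<open>alt_term_telescopes\<close>). The floor makes the shape of the terms depend on
  \<open>s = (2n + 7j + 6) mod 4\<close>, which runs through \<open>0, 3, 2, 1\<close> cyclically as \<open>j\<close> increases.
  In each residue class the two Pascal rules absorb the term with coefficient \<open>q\<^bsup>2n\<^esup>\<close> of the
  recurrence and reduce the defect to three Gaussian polynomials of height \<open>n - 1\<close> and \<open>n - 2\<close>
  (lemmas \<open>defect_low\<close> and \<open>defect_high\<close>). The ratio of the weights at consecutive \<open>j\<close> is, up to
  sign, a power of \<open>q\<close> times \<open>q\<^bsup>4B\<^esup> / q\<^bsup>2n\<^esup>\<close>, with \<open>B\<close> the floor, and this is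
  just what makes the remaining pieces cancel between neighbours.
\<close>

section \<open>Dilation of formal power series\<close>

definition fps_dilate :: "'a::field \<Rightarrow> 'a fps \<Rightarrow> 'a fps" where
  "fps_dilate c f = f oo (fps_const c * fps_X)"

lemma fps_dilate_nth [simp]: "fps_nth (fps_dilate c f) n = c ^ n * fps_nth f n"
  by (simp add: fps_dilate_def fps_compose_linear)

lemma fps_dilate_mult: "fps_dilate c (f * g) = fps_dilate c f * fps_dilate c g"
  by (simp add: fps_dilate_def fps_compose_mult_distrib)

lemma fps_dilate_dilate: "fps_dilate c (fps_dilate d f) = fps_dilate (c * d) f"
  by (rule fps_ext) (simp add: power_mult_distrib)

lemma fps_dilate_const: "fps_dilate c (fps_const a) = fps_const a"
  by (rule fps_ext) simp

lemma fps_dilate_1: "fps_dilate c 1 = 1"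
  by (rule fps_ext) simp

lemma fps_dilate_X_power: "fps_dilate c (fps_X ^ k) = fps_const (c ^ k) * fps_X ^ k"
  by (rule fps_ext) (simp add: fps_X_power_nth)

lemma fps_dilate_1_minus_X: "fps_dilate c (1 - fps_X) = 1 - fps_const c * fps_X"
  by (rule fps_ext) (simp add: fps_X_def)

section \<open>Gaussian polynomials\<close>

text \<open>
  If \<open>p\<close> is not a root of unity then no denominator of a Gaussian polynomial vanishes.
\<close>

locale generic_base =
  fixes p :: "'a::field"
  assumes power_neq_1: "m > 0 \<Longrightarrow> p ^ m \<noteq> 1"
begin

lemma qpoch_nonzero: "qpoch p p n \<noteq> 0"
  using power_neq_1[of "Suc _"] by (auto simp: qpoch_def)

lemma gauss_poly_symmetric: "gauss_poly p N (N - B) = gauss_poly p N B"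
  by (auto simp: gauss_poly_def mult.commute)

lemma gauss_poly_0_right: "N \<ge> 0 \<Longrightarrow> gauss_poly p N 0 = 1"
  by (auto simp: gauss_poly_def qpoch_nonzero) (simp add: qpoch_def)

lemma gauss_poly_pascal_nat:
  assumes "b \<le> m"
  shows "gauss_poly p (int m + 2) (int b + 1)
    = gauss_poly p (int m + 1) (int b) + p ^ Suc b * gauss_poly p (int m + 1) (int b + 1)"
proof -
  define c where "c = m - b"
  have m: "m = b + c" using assms by (simp add: c_def)
  have n: "nat (int m + 2) = Suc (Suc m)" "nat (int m + 1) = Suc m" "nat (int b + 1) = Suc b"
    "nat (int m + 2 - (int b + 1)) = Suc c" "nat (int m + 1 - int b) = Suc c"
    "nat (int m + 1 - (int b + 1)) = c"
    by (auto simp: m)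
  have S: "qpoch p p (Suc k) = qpoch p p k * (1 - p ^ Suc k)" for k
    by (simp add: qpoch_def)
  have nz: "1 - p ^ Suc k \<noteq> 0" for k
    using power_neq_1[of "Suc k"] by simp
  have e: "1 - p ^ Suc (Suc m) = (1 - p ^ Suc b) + p ^ Suc b * (1 - p ^ Suc c)"
    by (simp add: m power_add algebra_simps)
  let ?x = "qpoch p p (Suc m)" and ?y = "qpoch p p b" and ?z = "qpoch p p c"
  have "gauss_poly p (int m + 2) (int b + 1) =
     ?x * (1 - p ^ Suc (Suc m)) / (?y * (1 - p ^ Suc b) * (?z * (1 - p ^ Suc c)))"
    using assms unfolding gauss_poly_def n by (simp only: S[of b] S[of c] S[of "Suc m"]) auto
  also have "\<dots> = ?x / (?y * (?z * (1 - p ^ Suc c)))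
      + p ^ Suc b * (?x / (?y * (1 - p ^ Suc b) * ?z))"
    unfolding e using nz[of b] nz[of c] qpoch_nonzero[of b] qpoch_nonzero[of c]
    by (simp add: divide_simps del: power_Suc) (simp add: algebra_simps del: power_Suc)
  also have "\<dots> = gauss_poly p (int m + 1) (int b)
      + p ^ Suc b * gauss_poly p (int m + 1) (int b + 1)"
    using assms unfolding gauss_poly_def n by (simp only: S[of b] S[of c]) auto
  finally show ?thesis .
qed

text \<open>
  Both Pascal rules hold for every integer \<open>B\<close> as long as \<open>N \<ge> 0\<close>: this is what allows
  sums over all integers to be handled without boundary cases.
\<close>

lemma gauss_poly_pascal:
  assumes "N \<ge> 0"
  shows "gauss_poly p (N + 1) B = gauss_poly p N (B - 1) + p powi B * gauss_poly p N B"
proof -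
  consider "B < 0 \<or> B > N + 1" | "B = 0" | "B = N + 1" | "0 < B" "B \<le> N" by linarith
  then show ?thesis
  proof cases
    case 4
    then have "int (nat (N - 1)) = N - 1" "int (nat (B - 1)) = B - 1" "nat (B - 1) \<le> nat (N - 1)"
      by auto
    with gauss_poly_pascal_nat[of "nat (B - 1)" "nat (N - 1)"] 4 show ?thesis
      by (auto simp: power_int_def Suc_nat_eq_nat_zadd1 add.commute)
  next
    case 3
    then show ?thesis
      using gauss_poly_symmetric[of N 0] gauss_poly_symmetric[of "N + 1" 0] assms
      by (auto simp: gauss_poly_0_right) (auto simp: gauss_poly_def)
  next
    case 2
    then show ?thesis
      using assms gauss_poly_0_right[of N] gauss_poly_0_right[of "N + 1"]
      by (simp add: gauss_poly_def)
  qed (use assms in \<open>auto simp: gauss_poly_def\<close>)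
qed

lemma gauss_poly_pascal':
  assumes "N \<ge> 0"
  shows "gauss_poly p (N + 1) B = gauss_poly p N B + p powi (N + 1 - B) * gauss_poly p N (B - 1)"
  using gauss_poly_pascal[OF assms, of "N + 1 - B"] gauss_poly_symmetric[of "N + 1" B]
    gauss_poly_symmetric[of N B] gauss_poly_symmetric[of N "B - 1"]
  by (simp add: algebra_simps)

text \<open>This is the expansion of \<open>1 / (x;p)\<^bsub>j+1\<^esub>\<close>, by the \<open>q\<close>-binomial theorem.\<close>

definition gauss_fps :: "nat \<Rightarrow> 'a fps" where
  "gauss_fps j = Abs_fps (\<lambda>m. gauss_poly p (int m + int j) (int j))"

lemma gauss_fps_0: "(1 - fps_X) * gauss_fps 0 = 1"
  by (rule fps_ext) (simp add: gauss_fps_def gauss_poly_0_right left_diff_distrib)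

text \<open>
  Removing the first factor of \<open>(x;p)\<^bsub>j+2\<^esub>\<close> leaves \<open>(px;p)\<^bsub>j+1\<^esub>\<close>. On coefficients
  this is the second Pascal rule.
\<close>

lemma gauss_fps_Suc: "(1 - fps_X) * gauss_fps (Suc j) = fps_dilate p (gauss_fps j)"
proof (rule fps_ext)
  fix m
  show "fps_nth ((1 - fps_X) * gauss_fps (Suc j)) m = fps_nth (fps_dilate p (gauss_fps j)) m"
  proof (cases m)
    case 0
    then show ?thesis
      using gauss_poly_symmetric[of "int j" 0] gauss_poly_symmetric[of "1 + int j" 0]
      by (simp add: gauss_fps_def left_diff_distrib gauss_poly_0_right)
  next
    case (Suc k)
    have "gauss_poly p (int k + int j + 2) (int j + 1) - gauss_poly p (int k + int j + 1) (int j + 1)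
        = p ^ Suc k * gauss_poly p (int k + int j + 1) (int j)"
      using gauss_poly_pascal'[of "int k + int j + 1" "int j + 1"]
      by (simp add: power_int_def nat_add_distrib algebra_simps)
    with Suc show ?thesis
      by (simp add: gauss_fps_def algebra_simps)
  qed
qed

lemma dilate_gauss_fps_Suc:
  "(1 - fps_const c * fps_X) * fps_dilate c (gauss_fps (Suc j)) = fps_dilate (c * p) (gauss_fps j)"
  using arg_cong[OF gauss_fps_Suc, of "fps_dilate c"]
  by (simp add: fps_dilate_mult fps_dilate_1_minus_X fps_dilate_dilate)

lemma dilate_gauss_fps_0: "(1 - fps_const c * fps_X) * fps_dilate c (gauss_fps 0) = 1"
  using arg_cong[OF gauss_fps_0, of "fps_dilate c"]
  by (simp add: fps_dilate_mult fps_dilate_1_minus_X fps_dilate_1)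

end

section \<open>The double sum\<close>

interpretation base_q: generic_base q
  by unfold_locales (rule q_power_neq_1)

interpretation base_q2: generic_base "q\<^sup>2"
  by unfold_locales (simp flip: power_mult add: q_power_neq_1)

text \<open>
  The series \<open>t\<^sub>j\<close> from the introduction, with the reciprocal products in expanded form.
\<close>

definition P_summand_fps :: "nat \<Rightarrow> int poly fract fps" where
  "P_summand_fps j = fps_const (q ^ (2 * j\<^sup>2 + 2 * j)) * fps_X ^ (2 * j)
     * (base_q2.gauss_fps j * fps_dilate (- q) (base_q.gauss_fps (2 * j)))"

definition P_denominator :: "int poly fract fps" where
  "P_denominator = (1 - fps_X) * (1 + fps_const q * fps_X) * (1 + fps_const (q\<^sup>2) * fps_X)"

lemma P_summand_fps_0: "P_denominator * P_summand_fps 0 = 1 + fps_const (q\<^sup>2) * fps_X"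
proof -
  have "P_denominator * P_summand_fps 0 = (1 + fps_const (q\<^sup>2) * fps_X) * ((1 - fps_X) * base_q2.gauss_fps 0)
      * ((1 - fps_const (- q) * fps_X) * fps_dilate (- q) (base_q.gauss_fps 0))"
    by (simp add: P_denominator_def P_summand_fps_def mult_ac flip: fps_const_neg)
  then show ?thesis
    by (simp only: base_q2.gauss_fps_0 base_q.dilate_gauss_fps_0 mult_1_right)
qed

text \<open>
  One factor of \<open>P_denominator\<close> comes from \<open>(x;q\<^sup>2)\<^bsub>j+2\<^esub>\<close>, which becomes
  \<open>(q\<^sup>2 x;q\<^sup>2)\<^bsub>j+1\<^esub>\<close>, and two come from \<open>(-qx;q)\<^bsub>2j+3\<^esub>\<close>, which becomes
  \<open>(-q\<^sup>3 x;q)\<^bsub>2j+1\<^esub>\<close>: in both products \<open>x\<close> has turned into \<open>q\<^sup>2 x\<close>.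
\<close>

lemma P_summand_fps_Suc:
  "P_denominator * P_summand_fps (Suc j) = fps_const (q ^ 4) * fps_X\<^sup>2 * fps_dilate (q\<^sup>2) (P_summand_fps j)"
proof -
  have c: "fps_const (q ^ (2 * (Suc j)\<^sup>2 + 2 * Suc j)) =
      fps_const (q ^ 4) * fps_const (q ^ (2 * j\<^sup>2 + 2 * j)) * fps_const ((q\<^sup>2) ^ (2 * j))"
  proof -
    have e: "2 * (Suc j)\<^sup>2 + 2 * Suc j = 4 + (2 * j\<^sup>2 + 2 * j) + 2 * (2 * j)"
      by (simp add: power2_eq_square)
    show ?thesis
      by (simp only: e power_add fps_const_mult[symmetric] power_mult)
  qed
  have neg: "1 + fps_const a * fps_X = 1 - fps_const (- a) * fps_X" for a :: "int poly fract"
    by (simp flip: fps_const_neg)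
  have 1: "(1 + fps_const q * fps_X) * fps_dilate (- q) (base_q.gauss_fps (Suc (Suc (2 * j))))
      = fps_dilate (- q\<^sup>2) (base_q.gauss_fps (Suc (2 * j)))"
    unfolding neg by (subst base_q.dilate_gauss_fps_Suc) (simp add: power2_eq_square)
  have 2: "(1 + fps_const (q\<^sup>2) * fps_X) * fps_dilate (- q\<^sup>2) (base_q.gauss_fps (Suc (2 * j)))
      = fps_dilate (q\<^sup>2) (fps_dilate (- q) (base_q.gauss_fps (2 * j)))"
    unfolding neg by (subst base_q.dilate_gauss_fps_Suc) (simp add: fps_dilate_dilate)
  have "P_denominator * P_summand_fps (Suc j) =
      fps_const (q ^ (2 * (Suc j)\<^sup>2 + 2 * Suc j)) * fps_X\<^sup>2 * fps_X ^ (2 * j)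
      * ((1 - fps_X) * base_q2.gauss_fps (Suc j))
      * ((1 + fps_const (q\<^sup>2) * fps_X) * ((1 + fps_const q * fps_X)
          * fps_dilate (- q) (base_q.gauss_fps (Suc (Suc (2 * j))))))"
    by (simp add: P_denominator_def P_summand_fps_def mult_ac power2_eq_square)
  also have "\<dots> = fps_const (q ^ 4) * fps_X\<^sup>2 * fps_dilate (q\<^sup>2) (P_summand_fps j)"
    unfolding 1 2 base_q2.gauss_fps_Suc c P_summand_fps_def
    by (simp only: fps_dilate_mult fps_dilate_const fps_dilate_X_power mult_ac)
  finally show ?thesis .
qed

lemma P_summand_fps_nth: "fps_nth (P_summand_fps j) n = Sum_any (\<lambda>k. P_term n j k)"
proof (cases "n < 2 * j")
  case True
  then have "P_term n j k = 0" for k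
    by (intro P_term_eq_0) simp
  with True show ?thesis
    by (simp add: P_summand_fps_def fps_X_power_mult_nth mult.assoc)
next
  case False
  have "fps_nth (P_summand_fps j) n = (\<Sum>k\<le>n - 2 * j. q ^ (2 * j\<^sup>2 + 2 * j) *
      (fps_nth (fps_dilate (- q) (base_q.gauss_fps (2 * j))) k
       * fps_nth (base_q2.gauss_fps j) (n - 2 * j - k)))"
    using False
    by (simp only: P_summand_fps_def fps_X_power_mult_nth fps_mult_left_const_nth mult.assoc if_False
        sum_distrib_left mult.commute[of "base_q2.gauss_fps j"] fps_mult_nth[of "fps_dilate _ _"]
        atLeast0AtMost)
  also have "\<dots> = (\<Sum>k\<le>n - 2 * j. P_term n j k)"
  proof (rule sum.cong)
    fix k assume k: "k \<in> {..n - 2 * j}"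
    have e: "int (n - 2 * j - k) + int j = int n - int j - int k"
      using k False by auto
    have "gauss_poly q (int k + int (2 * j)) (int (2 * j)) = gauss_poly q (2 * int j + int k) (int k)"
      using base_q.gauss_poly_symmetric[of "2 * int j + int k" "int k"]
      by (simp add: add.commute)
    then show "q ^ (2 * j\<^sup>2 + 2 * j) * (fps_nth (fps_dilate (- q) (base_q.gauss_fps (2 * j))) k
       * fps_nth (base_q2.gauss_fps j) (n - 2 * j - k)) = P_term n j k"
      unfolding P_term_def fps_dilate_nth base_q.gauss_fps_def base_q2.gauss_fps_def fps_nth_Abs_fps e
      by (simp add: power_add power_minus[of q k])
  qed simp
  also have "\<dots> = Sum_any (\<lambda>k. P_term n j k)"
  proof (rule Sum_any.expand_superset[symmetric])
    show "{k. P_term n j k \<noteq> 0} \<subseteq> {..n - 2 * j}"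
    proof (rule subsetI, rule ccontr)
      fix k assume "k \<in> {k. P_term n j k \<noteq> 0}" "k \<notin> {..n - 2 * j}"
      moreover from this have "n < 2 * j + k" using False by auto
      ultimately show False using P_term_eq_0[of n j k] by simp
    qed
  qed simp
  finally show ?thesis .
qed

text \<open>
  \<open>P_summand_fps j\<close> is divisible by \<open>x\<^bsup>2j\<^esup>\<close>, so finite partial sums determine each coefficient
  and no infinite sum of power series is needed.
\<close>

lemma P_eq_nth_sum:
  assumes "n < M"
  shows "P n = fps_nth (\<Sum>j<M. P_summand_fps j) n"
proof -
  have "fps_nth (P_summand_fps j) n = 0" if "\<not> j < M" for j
    using that assms by (simp add: P_summand_fps_def fps_X_power_mult_nth mult.assoc)
  then have "{j. fps_nth (P_summand_fps j) n \<noteq> 0} \<subseteq> {..<M}"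
    by auto
  then show ?thesis
    unfolding P_def P_summand_fps_nth[symmetric] fps_sum_nth
    by (intro Sum_any.expand_superset) auto
qed

lemma P_functional_equation:
  "P_denominator * (\<Sum>j<Suc M. P_summand_fps j) = 1 + fps_const (q\<^sup>2) * fps_X
     + fps_const (q ^ 4) * (fps_X\<^sup>2 * fps_dilate (q\<^sup>2) (\<Sum>j<M. P_summand_fps j))"
  (is "_ = _ + _ * (_ * fps_dilate _ ?G)")
proof -
  have "P_denominator * (\<Sum>j<Suc M. P_summand_fps j) = P_denominator * P_summand_fps 0 + (\<Sum>j<M. P_denominator * P_summand_fps (Suc j))"
    by (simp only: sum.lessThan_Suc_shift sum_distrib_left distrib_left)
  also have "(\<Sum>j<M. P_denominator * P_summand_fps (Suc j)) = fps_const (q ^ 4) * (fps_X\<^sup>2 * fps_dilate (q\<^sup>2) ?G)"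
    by (simp only: P_summand_fps_Suc fps_dilate_def fps_compose_sum_distrib sum_distrib_left mult.assoc)
  finally show ?thesis
    by (simp only: P_summand_fps_0)
qed

lemma P_denominator_mult_nth:
  "fps_nth (P_denominator * f) n = fps_nth f n
     - (1 - q - q\<^sup>2) * (if n < 1 then 0 else fps_nth f (n - 1))
     - (q + q\<^sup>2 - q ^ 3) * (if n < 2 then 0 else fps_nth f (n - 2))
     - q ^ 3 * (if n < 3 then 0 else fps_nth f (n - 3))"
proof -
  have "P_denominator * f = f - fps_const (1 - q - q\<^sup>2) * (fps_X ^ 1 * f)
     - fps_const (q + q\<^sup>2 - q ^ 3) * (fps_X ^ 2 * f) - fps_const (q ^ 3) * (fps_X ^ 3 * f)"
  proof -
    define c where "c = fps_const q"
    have c: "fps_const (q\<^sup>2) = c\<^sup>2" "fps_const (q ^ 3) = c ^ 3"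
      "fps_const (1 - q - q\<^sup>2) = 1 - c - c\<^sup>2"
      "fps_const (q + q\<^sup>2 - q ^ 3) = c + c\<^sup>2 - c ^ 3"
      by (simp_all add: c_def fps_const_power flip: fps_const_1_eq_1)
    show ?thesis
      unfolding P_denominator_def c c_def[symmetric] by algebra
  qed
  then show ?thesis
    by (simp only: fps_sub_nth fps_mult_left_const_nth fps_X_power_mult_nth)
qed

lemma P_recurrence_general:
  "P n - (1 - q - q\<^sup>2) * (if n < 1 then 0 else P (n - 1))
     - (q + q\<^sup>2 - q ^ 3) * (if n < 2 then 0 else P (n - 2))
     - q ^ 3 * (if n < 3 then 0 else P (n - 3))
   = (if n = 0 then 1 else 0) + (if n = 1 then q\<^sup>2 else 0)
     + (if n < 2 then 0 else q ^ (2 * n) * P (n - 2))"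
proof -
  have q4: "q ^ 4 * (q\<^sup>2) ^ (n - 2) = q ^ (2 * n)" if "\<not> n < 2"
  proof -
    have "2 * n = 4 + 2 * (n - 2)" using that by simp
    then show ?thesis by (simp only: power_add power_mult)
  qed
  show ?thesis
    using arg_cong[OF P_functional_equation[of "Suc n"], of "\<lambda>f. fps_nth f n"] q4
    unfolding P_denominator_mult_nth fps_add_nth fps_mult_left_const_nth fps_X_power_mult_nth fps_dilate_nth
    by (cases "n = 1") (auto simp: P_eq_nth_sum[symmetric] fps_X_nth split: if_splits simp del: sum.lessThan_Suc)
qed

lemma P_0: "P 0 = 1"
  using P_recurrence_general[of 0] by simp

lemma P_1: "P 1 = - q + 1"
  using P_recurrence_general[of 1] by (simp add: P_0 algebra_simps)

lemma P_2: "P 2 = q ^ 4 + q\<^sup>2 - q + 1"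
proof -
  have "P (Suc 0) = 1 - q" using P_1 by simp
  with P_recurrence_general[of 2] show ?thesis
    by (simp add: P_0 algebra_simps power2_eq_square power3_eq_cube power4_eq_xxxx)
qed

lemma P_recurrence:
  assumes "n \<ge> 3"
  shows "P n = (1 - q - q\<^sup>2) * P (n - 1) + (q ^ (2 * n) - q ^ 3 + q\<^sup>2 + q) * P (n - 2)
    + q ^ 3 * P (n - 3)"
  using P_recurrence_general[of n] assms by (simp add: algebra_simps)

section \<open>The alternating sum\<close>

lemma q_nonzero: "q \<noteq> 0"
  by (simp add: q_def Zero_fract_def eq_fract)

definition weight :: "int \<Rightarrow> int poly fract" where
  "weight j = (-1) powi j * q powi (j * (7 * j + 5) div 2)"

lemma weight_pred: "weight (j - 1) = - weight j * q powi (1 - 7 * j)"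
proof -
  have "(j - 1) * (7 * (j - 1) + 5) = j * (7 * j + 5) + 2 * (1 - 7 * j)"
    by (simp add: algebra_simps)
  then have "(j - 1) * (7 * (j - 1) + 5) div 2 = j * (7 * j + 5) div 2 + (1 - 7 * j)"
    by simp
  then show ?thesis
    unfolding weight_def by (simp add: power_int_add power_int_diff q_nonzero)
qed

definition alt_term :: "int \<Rightarrow> int \<Rightarrow> int poly fract" where
  "alt_term n j = weight j * gauss_poly (q\<^sup>2) (n + 1) ((2 * n + 7 * j + 6) div 4)"

text \<open>
  The part of the recurrence defect at \<open>j\<close> that cancels against the defect at \<open>j + 1\<close>.
  Once the ratio of the weights is taken into account, several Gaussian polynomials occur with
  opposite coefficients in the reduced defects (below) at \<open>j\<close> and at \<open>j + 1\<close>. The others match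
  only up to a Pascal rule, and the terms with factor \<open>p n\<close> make up for the difference.
\<close>

definition telescoper :: "int \<Rightarrow> int \<Rightarrow> int poly fract" where
  "telescoper n j = (
     let B = (2 * n + 7 * j + 6) div 4; s = (2 * n + 7 * j + 6) mod 4;
         p = (\<lambda>i. q powi (2 * i)); g = gauss_poly (q\<^sup>2) (n - 1); h = gauss_poly (q\<^sup>2) (n - 2)
     in weight j *
      (if s = 0 then p B * g B + q ^ 3 * p (B - 1) * h (B - 1) + p n * h (B - 2)
       else if s = 1 then p B * g B + q * p B * h (B - 1)
       else if s = 2 then (q + q\<^sup>2) * p B * g B
       else (q + q\<^sup>2) * p B * g B - p n * h (B - 1)))"

text \<open>
  In the next two lemmas \<open>G\<^sub>1\<close> stands for the Gaussian polynomial of height \<open>n + 1\<close> at \<open>B\<close>,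
  \<open>G\<^sub>0\<close> and \<open>G\<^sub>2\<close> for those of height \<open>n\<close> at \<open>B\<close> and \<open>B - 1\<close>, \<open>g\<^sub>i\<close> for height \<open>n - 1\<close> at
  \<open>B - i\<close>, and \<open>h\<^sub>i\<close> for height \<open>n - 2\<close> at \<open>B - i\<close>; moreover \<open>a = q\<^bsup>2n\<^esup>\<close> and
  \<open>b = q\<^bsup>2B\<^esup>\<close>, while \<open>c\<close> and \<open>d\<close> are the powers of \<open>q\<close> in the respective Pascal rules.
  Expanding \<open>G\<^sub>1\<close> twice, once by each Pascal rule, produces exactly
  the term \<open>a g\<^sub>1\<close> that the recurrence subtracts.
\<close>

lemma defect_low:
  fixes q a b c d :: "'a::comm_ring_1"
  assumes "G1 = G2 + b * G0" "b * G0 = b * g0 + a * g1" "G2 = g1 + c * g2" "g1 = h2 + d * h1"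
  shows "G1 - (1 - q - q\<^sup>2) * G2 - (a - q ^ 3 + q\<^sup>2 + q) * g1 - q ^ 3 * h2
     = b * g0 + (q + q\<^sup>2) * c * g2 + q ^ 3 * d * h1"
  unfolding assms(1,2,3) unfolding assms(4) by (simp add: algebra_simps)

lemma defect_high:
  fixes q a b c d :: "'a::comm_ring_1"
  assumes "G1 = G0 + c * G2" "c * G2 = c * g2 + a * g1" "G0 = g1 + b * g0" "g1 = h1 + d * h2"
  shows "G1 - (1 - q - q\<^sup>2) * G0 - (a - q ^ 3 + q\<^sup>2 + q) * g1 - q ^ 3 * h1
     = c * g2 + (q + q\<^sup>2) * b * g0 + q ^ 3 * d * h2"
  unfolding assms(1,2,3) unfolding assms(4) by (simp add: algebra_simps)

text \<open>
  The four residues \<open>s\<close>, in the same notation. Each left-hand side is a reduced defect;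
  the factor \<open>- w (a q\<^bsup>7-s\<^esup> / b\<^sup>2)\<close> is the weight at \<open>j - 1\<close>.
\<close>

lemma telescope_residue_0:
  fixes q a b :: "'a::field"
  assumes "b \<noteq> 0" "q \<noteq> 0" "g2 = h3 + b / q ^ 4 * h2"
  shows "w * (b * g0 + (q + q\<^sup>2) * (a * q\<^sup>2 / b) * g2 + q ^ 3 * (b / q\<^sup>2) * h1)
   = w * (b * g0 + q ^ 3 * (b / q\<^sup>2) * h1 + a * h2)
     - - w * (a * q ^ 7 / b\<^sup>2) * (b / q ^ 4 * g2 + q * (b / q ^ 4) * h3)"
proof -
  have e: "h3 = g2 - b / q ^ 4 * h2" using assms(3) by simp
  show ?thesis unfolding e using assms(1,2) by (simp add: field_simps eval_nat_numeral)
qed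

lemma telescope_residue_1:
  fixes q a b :: "'a::field"
  assumes "b \<noteq> 0" "q \<noteq> 0"
  shows "w * (b * g0 + (q + q\<^sup>2) * (a * q\<^sup>2 / b) * g2 + q ^ 3 * (b / q\<^sup>2) * h1)
   = w * (b * g0 + q * b * h1) - - w * (a * q ^ 6 / b\<^sup>2) * ((q + q\<^sup>2) * (b / q ^ 4) * g2)"
  using assms by (simp add: field_simps eval_nat_numeral)

lemma telescope_residue_2:
  fixes q a b :: "'a::field"
  assumes "b \<noteq> 0" "q \<noteq> 0" "g2 = h2 + a * q\<^sup>2 / b * h3"
  shows "w * (a * q\<^sup>2 / b * g2 + (q + q\<^sup>2) * b * g0 + q ^ 3 * (a / b) * h2)
   = w * ((q + q\<^sup>2) * b * g0) - - w * (a * q ^ 5 / b\<^sup>2) * ((q + q\<^sup>2) * (b / q ^ 4) * g2 - a * h3)"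
proof -
  have e: "h2 = g2 - a * q\<^sup>2 / b * h3" using assms(3) by simp
  show ?thesis unfolding e using assms(1,2) by (simp add: field_simps eval_nat_numeral)
qed

lemma telescope_residue_3:
  fixes q a b :: "'a::field"
  assumes "b \<noteq> 0" "q \<noteq> 0"
    and g: "g1 = h2 + b / q\<^sup>2 * h1" "g2 = h2 + a * q\<^sup>2 / b * h3"
  shows "w * (a * q\<^sup>2 / b * g2 + (q + q\<^sup>2) * b * g0 + q ^ 3 * (a / b) * h2)
   = w * ((q + q\<^sup>2) * b * g0 - a * h1)
     - - w * (a * q ^ 4 / b\<^sup>2) * (b / q\<^sup>2 * g1 + q ^ 3 * (b / q ^ 4) * h2 + a * h3)"
  unfolding g using assms(1,2) by (simp add: field_simps eval_nat_numeral)

lemma alt_term_telescopes: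
  assumes "n \<ge> 2"
  shows "alt_term n j - (1 - q - q\<^sup>2) * alt_term (n - 1) j
      - (q powi (2 * n) - q ^ 3 + q\<^sup>2 + q) * alt_term (n - 2) j - q ^ 3 * alt_term (n - 3) j
    = telescoper n j - telescoper n (j - 1)"
proof -
  define B where "B = (2 * n + 7 * j + 6) div 4"
  define s where "s = (2 * n + 7 * j + 6) mod 4"
  have j: "2 * n + 7 * j + 6 = 4 * B + s"
    by (simp add: B_def s_def)
  have s: "0 \<le> s" "s < 4"
    by (simp_all add: s_def)
  define a where "a = q powi (2 * n)"
  define b where "b = q powi (2 * B)"
  define g where "g = gauss_poly (q\<^sup>2) (n - 1)"
  define h where "h = gauss_poly (q\<^sup>2) (n - 2)"
  define w where "w = weight j"
  have b0: "b \<noteq> 0" by (simp add: b_def q_nonzero)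
  have pB: "q powi (2 * (B - 1)) = b / q\<^sup>2" "q powi (2 * (B - 2)) = b / q ^ 4"
    "q powi (2 * B) = b" "q powi (2 * n) = a"
    by (simp_all add: a_def b_def power_int_diff q_nonzero right_diff_distrib)
  have pq: "(q\<^sup>2) powi B = b" "(q\<^sup>2) powi (B - 1) = b / q\<^sup>2" "(q\<^sup>2) powi (B - 2) = b / q ^ 4"
    "(q\<^sup>2) powi (n + 1 - B) = a * q\<^sup>2 / b" "(q\<^sup>2) powi (n - B) = a / b"
    unfolding power_int_mult[of q 2, simplified, symmetric] right_diff_distrib distrib_left
    by (simp_all add: a_def b_def power_int_diff power_int_add q_nonzero)
  have wp: "weight (j - 1) = - w * (a * q ^ nat (7 - s) / b\<^sup>2)"
  proof -
    have s7: "q powi (7 - s) = q ^ nat (7 - s)" using s by (simp add: power_int_def)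
    have "1 - 7 * j = 2 * n + (7 - s) - (2 * B + 2 * B)" using j by simp
    then have "q powi (1 - 7 * j) = a * q ^ nat (7 - s) / b\<^sup>2"
      using q_nonzero unfolding a_def b_def s7[symmetric] power2_eq_square
      by (simp only: power_int_add power_int_diff simp_thms)
    then show ?thesis by (simp add: weight_pred w_def)
  qed
  have g1: "g (B - 1) = h (B - 2) + b / q\<^sup>2 * h (B - 1)"
      "g (B - 1) = h (B - 1) + a / b * h (B - 2)"
    and g2: "g (B - 2) = h (B - 3) + b / q ^ 4 * h (B - 2)"
      "g (B - 2) = h (B - 2) + a * q\<^sup>2 / b * h (B - 3)"
    using base_q2.gauss_poly_pascal[of "n - 2" "B - 1"] base_q2.gauss_poly_pascal[of "n - 2" "B - 2"]
      base_q2.gauss_poly_pascal'[of "n - 2" "B - 1"] base_q2.gauss_poly_pascal'[of "n - 2" "B - 2"]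
      assms pq by (simp_all add: g_def h_def algebra_simps)
  let ?G = "gauss_poly (q\<^sup>2)"
  have G: "?G (n + 1) B = ?G n (B - 1) + b * ?G n B"
       "?G (n + 1) B = ?G n B + a * q\<^sup>2 / b * ?G n (B - 1)"
       "?G n B = g (B - 1) + b * g B" "?G n B = g B + a / b * g (B - 1)"
       "?G n (B - 1) = g (B - 2) + b / q\<^sup>2 * g (B - 1)"
       "?G n (B - 1) = g (B - 1) + a * q\<^sup>2 / b * g (B - 2)"
    using base_q2.gauss_poly_pascal[of n B] base_q2.gauss_poly_pascal'[of n B]
      base_q2.gauss_poly_pascal[of "n - 1" B] base_q2.gauss_poly_pascal'[of "n - 1" B]
      base_q2.gauss_poly_pascal[of "n - 1" "B - 1"] base_q2.gauss_poly_pascal'[of "n - 1" "B - 1"]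
      assms pq by (simp_all add: g_def algebra_simps)
  have div4: "t div 4 = x" if "4 * x \<le> t" "t < 4 * x + 4" for t x :: int
    using that by linarith
  have mod4: "t mod 4 = y" if "t = 4 * x + y" "0 \<le> y" "y < 4" for t x y :: int
    using that by simp
  have ind: "(2 * (n - 2) + 7 * j + 6) div 4 = B - 1"
    "(2 * (n - 1) + 7 * j + 6) div 4 = (if s < 2 then B - 1 else B)"
    "(2 * (n - 3) + 7 * j + 6) div 4 = (if s < 2 then B - 2 else B - 1)"
    using j s by (auto intro!: div4)
  have idx: "B - 1 - 1 = B - 2" "B - 1 - 2 = B - 3" "B - 2 - 1 = B - 3"
    by simp_all
  let ?lhs = "alt_term n j - (1 - q - q\<^sup>2) * alt_term (n - 1) j
      - (a - q ^ 3 + q\<^sup>2 + q) * alt_term (n - 2) j - q ^ 3 * alt_term (n - 3) j"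
  have lhs: "?lhs = w * (?G (n + 1) B - (1 - q - q\<^sup>2) * ?G n (if s < 2 then B - 1 else B)
        - (a - q ^ 3 + q\<^sup>2 + q) * g (B - 1) - q ^ 3 * h (if s < 2 then B - 2 else B - 1))"
    unfolding alt_term_def ind B_def[symmetric] w_def[symmetric] g_def h_def
    by (simp add: right_diff_distrib mult_ac)
  have low: "?lhs = w * (b * g B + (q + q\<^sup>2) * (a * q\<^sup>2 / b) * g (B - 2)
      + q ^ 3 * (b / q\<^sup>2) * h (B - 1))" if "s < 2"
  proof -
    have "b * ?G n B = b * g B + a * g (B - 1)"
      unfolding G(4) using b0 by (simp add: distrib_left)
    from defect_low[OF G(1) this G(6) g1(1), of q] show ?thesis
      unfolding lhs using that by (simp only: if_True)
  qed
  have high: "?lhs = w * (a * q\<^sup>2 / b * g (B - 2) + (q + q\<^sup>2) * b * g B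
      + q ^ 3 * (a / b) * h (B - 2))" if "\<not> s < 2"
  proof -
    have "a * q\<^sup>2 / b * ?G n (B - 1) = a * q\<^sup>2 / b * g (B - 2) + a * g (B - 1)"
      unfolding G(5) using b0 q_nonzero by (simp add: distrib_left)
    from defect_high[OF G(2) this G(3) g1(2), of q] show ?thesis
      unfolding lhs using that by (simp only: if_False)
  qed
  note unfold_telescoper = telescoper_def Let_def B_def[symmetric] s_def[symmetric]
    w_def[symmetric] g_def[symmetric] h_def[symmetric]
  consider "s = 0" | "s = 1" | "s = 2" | "s = 3" using s by linarith
  then have "?lhs = telescoper n j - telescoper n (j - 1)"
  proof cases
    case 1
    have pred: "(2 * n + 7 * (j - 1) + 6) div 4 = B - 2" "(2 * n + 7 * (j - 1) + 6) mod 4 = 1"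
      using j 1 by (auto intro!: div4 mod4[of _ "B - 2"])
    have "telescoper n j = w * (b * g B + q ^ 3 * (b / q\<^sup>2) * h (B - 1) + a * h (B - 2))"
      unfolding unfold_telescoper pB using 1 by simp
    moreover have "telescoper n (j - 1) =
        - w * (a * q ^ 7 / b\<^sup>2) * (b / q ^ 4 * g (B - 2) + q * (b / q ^ 4) * h (B - 3))"
      unfolding unfold_telescoper pred idx pB wp using 1 by simp
    ultimately show ?thesis
      using low 1 telescope_residue_0[OF b0 q_nonzero g2(1)] by (simp only:)
  next
    case 2
    have pred: "(2 * n + 7 * (j - 1) + 6) div 4 = B - 2" "(2 * n + 7 * (j - 1) + 6) mod 4 = 2"
      using j 2 by (auto intro!: div4 mod4[of _ "B - 2"])
    have "telescoper n j = w * (b * g B + q * b * h (B - 1))"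
      unfolding unfold_telescoper pB using 2 by simp
    moreover have "telescoper n (j - 1) =
        - w * (a * q ^ 6 / b\<^sup>2) * ((q + q\<^sup>2) * (b / q ^ 4) * g (B - 2))"
      unfolding unfold_telescoper pred idx pB wp using 2 by simp
    ultimately show ?thesis
      using low 2 telescope_residue_1[OF b0 q_nonzero] by (simp only:)
  next
    case 3
    have pred: "(2 * n + 7 * (j - 1) + 6) div 4 = B - 2" "(2 * n + 7 * (j - 1) + 6) mod 4 = 3"
      using j 3 by (auto intro!: div4 mod4[of _ "B - 2"])
    have "telescoper n j = w * ((q + q\<^sup>2) * b * g B)"
      unfolding unfold_telescoper pB using 3 by simp
    moreover have "telescoper n (j - 1) =
        - w * (a * q ^ 5 / b\<^sup>2) * ((q + q\<^sup>2) * (b / q ^ 4) * g (B - 2) - a * h (B - 3))"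
      unfolding unfold_telescoper pred idx pB wp using 3 by simp
    ultimately show ?thesis
      using high 3 telescope_residue_2[OF b0 q_nonzero g2(2)] by (simp only:)
  next
    case 4
    have pred: "(2 * n + 7 * (j - 1) + 6) div 4 = B - 1" "(2 * n + 7 * (j - 1) + 6) mod 4 = 0"
      using j 4 by (auto intro!: div4 mod4[of _ "B - 1"])
    have "telescoper n j = w * ((q + q\<^sup>2) * b * g B - a * h (B - 1))"
      unfolding unfold_telescoper pB using 4 by simp
    moreover have "telescoper n (j - 1) = - w * (a * q ^ 4 / b\<^sup>2) *
        (b / q\<^sup>2 * g (B - 1) + q ^ 3 * (b / q ^ 4) * h (B - 2) + a * h (B - 3))"
      unfolding unfold_telescoper pred idx pB wp using 4 by simp
    ultimately show ?thesis
      using high 4 telescope_residue_3[OF b0 q_nonzero g1(1) g2(2)] by (simp only:)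
  qed
  then show ?thesis
    unfolding a_def .
qed

lemma gauss_poly_eq_0: "B < 0 \<or> A < B \<Longrightarrow> gauss_poly p A B = 0"
  by (auto simp: gauss_poly_def)

lemma alt_term_eq_0:
  assumes "j < - int n - 6 \<or> int n + 6 < j"
  shows "alt_term (int n) j = 0"
proof -
  have "(2 * int n + 7 * j + 6) div 4 < 0 \<or> int n + 1 < (2 * int n + 7 * j + 6) div 4"
    using assms by linarith
  then show ?thesis
    by (simp add: alt_term_def gauss_poly_eq_0)
qed

lemma telescoper_eq_0:
  assumes "j < - int n - 6 \<or> int n + 6 \<le> j"
  shows "telescoper (int n) j = 0"
proof -
  define B where "B = (2 * int n + 7 * j + 6) div 4"
  have "B < 0 \<or> int n < B"
    using assms unfolding B_def by linarith
  then show ?thesis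
    unfolding telescoper_def Let_def B_def[symmetric]
    by (auto simp: gauss_poly_eq_0)
qed

definition alt_sum :: "nat \<Rightarrow> int poly fract" where
  "alt_sum n = Sum_any (alt_term (int n))"

lemma alt_sum_eq_sum:
  assumes "n \<le> m"
  shows "alt_sum n = (\<Sum>j\<in>{- int (m + 6)..int (m + 6)}. alt_term (int n) j)"
  unfolding alt_sum_def
proof (rule Sum_any.expand_superset)
  show "{j. alt_term (int n) j \<noteq> 0} \<subseteq> {- int (m + 6)..int (m + 6)}"
  proof (rule subsetI, rule ccontr)
    fix j assume *: "j \<in> {j. alt_term (int n) j \<noteq> 0}" "j \<notin> {- int (m + 6)..int (m + 6)}"
    then have "j < - int n - 6 \<or> int n + 6 < j" using assms by auto
    with * alt_term_eq_0 show False by simp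
  qed
qed simp

lemma sum_telescope_symmetric:
  fixes f :: "int \<Rightarrow> 'a::ab_group_add"
  shows "(\<Sum>j\<in>{- int m..int m}. f j - f (j - 1)) = f (int m) - f (- int m - 1)"
proof (induction m)
  case (Suc m)
  have "{- int (Suc m)..int (Suc m)} = insert (- int m - 1) (insert (int m + 1) {- int m..int m})"
    by auto
  with Suc show ?case
    by (simp add: algebra_simps)
qed simp

lemma alt_sum_recurrence:
  assumes "n \<ge> 3"
  shows "alt_sum n = (1 - q - q\<^sup>2) * alt_sum (n - 1)
     + (q ^ (2 * n) - q ^ 3 + q\<^sup>2 + q) * alt_sum (n - 2) + q ^ 3 * alt_sum (n - 3)"
proof -
  let ?J = "{- int (n + 6)..int (n + 6)}"
  have i: "int (n - 1) = int n - 1" "int (n - 2) = int n - 2" "int (n - 3) = int n - 3"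
    using assms by auto
  have "q powi (2 * int n) = q ^ (2 * n)"
    by (simp add: power_int_def nat_mult_distrib)
  then have "alt_sum n - (1 - q - q\<^sup>2) * alt_sum (n - 1)
      - (q ^ (2 * n) - q ^ 3 + q\<^sup>2 + q) * alt_sum (n - 2) - q ^ 3 * alt_sum (n - 3)
    = (\<Sum>j\<in>?J. alt_term (int n) j - (1 - q - q\<^sup>2) * alt_term (int n - 1) j
      - (q powi (2 * int n) - q ^ 3 + q\<^sup>2 + q) * alt_term (int n - 2) j
      - q ^ 3 * alt_term (int n - 3) j)"
    by (simp only: alt_sum_eq_sum[of _ n] le_refl diff_le_self i sum_subtractf sum_distrib_left)
  also have "\<dots> = (\<Sum>j\<in>?J. telescoper (int n) j - telescoper (int n) (j - 1))"
    using assms by (intro sum.cong refl alt_term_telescopes) simp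
  also have "\<dots> = 0"
    unfolding sum_telescope_symmetric by (simp add: telescoper_eq_0)
  finally show ?thesis
    by (simp add: algebra_simps)
qed

text \<open>For \<open>n \<le> 2\<close> the index leaves the range \<open>0, \<dots>, n + 1\<close> unless \<open>j\<close> is \<open>-1\<close> or \<open>0\<close>.\<close>

lemma alt_sum_small:
  assumes "n \<le> 2"
  shows "alt_sum n = gauss_poly (q\<^sup>2) (int n + 1) ((2 * int n + 6) div 4)
    - q * gauss_poly (q\<^sup>2) (int n + 1) ((2 * int n - 1) div 4)"
proof -
  have "alt_sum n = (\<Sum>j\<in>{-1, 0}. alt_term (int n) j)"
    unfolding alt_sum_def
  proof (rule Sum_any.expand_superset)
    show "{j. alt_term (int n) j \<noteq> 0} \<subseteq> {-1, 0}"
    proof (rule subsetI, rule ccontr)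
      fix j assume *: "j \<in> {j. alt_term (int n) j \<noteq> 0}" "j \<notin> {-1, 0}"
      then have "j \<le> -2 \<or> 1 \<le> j" by auto
      then have "(2 * int n + 7 * j + 6) div 4 < 0 \<or> int n + 1 < (2 * int n + 7 * j + 6) div 4"
        using assms by linarith
      with * show False by (simp add: alt_term_def gauss_poly_eq_0)
    qed
  qed simp
  then show ?thesis
    by (simp add: alt_term_def weight_def)
qed

lemma gauss_poly_q2_self: "N \<ge> 0 \<Longrightarrow> gauss_poly (q\<^sup>2) N N = 1"
  using base_q2.gauss_poly_symmetric[of N 0] base_q2.gauss_poly_0_right[of N] by simp

lemma alt_sum_0: "alt_sum 0 = 1"
  by (simp add: alt_sum_small gauss_poly_q2_self gauss_poly_eq_0)

lemma alt_sum_1: "alt_sum 1 = - q + 1"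
  by (simp add: alt_sum_small gauss_poly_q2_self base_q2.gauss_poly_0_right)

lemma alt_sum_2: "alt_sum 2 = q ^ 4 + q\<^sup>2 - q + 1"
proof -
  have "gauss_poly (q\<^sup>2) 3 2 = 1 + q\<^sup>2 + q ^ 4"
    using base_q2.gauss_poly_pascal[of 2 2] base_q2.gauss_poly_pascal[of 1 1]
    by (simp add: gauss_poly_q2_self base_q2.gauss_poly_0_right flip: power_mult)
  then show ?thesis
    by (simp add: alt_sum_small base_q2.gauss_poly_0_right)
qed

section \<open>The identity\<close>

lemma P_eq_alt_sum: "P n = alt_sum n"
proof (induction n rule: less_induct)
  case (less n)
  consider "n = 0" | "n = 1" | "n = 2" | "n \<ge> 3" by linarith
  then show ?case
  proof cases
    case 4
    then have "P (n - 1) = alt_sum (n - 1)" "P (n - 2) = alt_sum (n - 2)" "P (n - 3) = alt_sum (n - 3)"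
      by (auto intro!: less)
    with 4 show ?thesis
      by (simp only: P_recurrence alt_sum_recurrence)
  qed (simp_all only: P_0 P_1 P_2 alt_sum_0 alt_sum_1 alt_sum_2)
qed

theorem mainTheorem9:
  shows "(\<forall>n. P n = Sum_any (\<lambda>j::int.
            (-1) powi j * q powi (j * (7 * j + 5) div 2)
              * gauss_poly (q\<^sup>2) (int n + 1) ((2 * int n + 7 * j + 6) div 4)))
    \<and> P 0 = 1 \<and> P 1 = - q + 1 \<and> P 2 = q ^ 4 + q\<^sup>2 - q + 1
    \<and> (\<forall>n\<ge>3. P n = (1 - q - q\<^sup>2) * P (n - 1)
                   + (q ^ (2 * n) - q ^ 3 + q\<^sup>2 + q) * P (n - 2)
                   + q ^ 3 * P (n - 3))"
proof (intro conjI allI impI)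
  fix n
  show "P n = Sum_any (\<lambda>j::int. (-1) powi j * q powi (j * (7 * j + 5) div 2)
      * gauss_poly (q\<^sup>2) (int n + 1) ((2 * int n + 7 * j + 6) div 4))"
    unfolding P_eq_alt_sum alt_sum_def alt_term_def weight_def ..
qed (simp_all only: P_0 P_1 P_2 P_recurrence)

end
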